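(* Let $G$ be a connected weighted multigraph on $n>1$ vertices with vertex set $V$, weighted adjacency matrix $A$, and positive edge weights (loops and multiple edges allowed). Let $\rho$ be the spectral radius of $A$, let $\mathcal{L}=\rho I-A$, let $p=(p_1,\ldots,p_n)^{T}$ be the Perron vector of $A$, and let $p'=(p'_1,\ldots,p'_n)^{T}=\sqrt{n}\,p/\|p\|_2$. Let $d^{\mathrm{LW}}$ be the long walk distance in $G$. Then for all $i,j\in V$ such that $j\neq i$, $$d^{\mathrm{LW}}(i,j)=\frac{\det\,(\mathcal{L}_{\overline{ii}})_{\overline{jj}}}{(p'_j)^2\,\det \mathcal{L}_{\overline{ii}}},$$ $$d^{\mathrm{LW}}(i,j)=z^{T}(i,j)\,\mathcal{L}^{-}\,z(i,j),$$ $$d^{\mathrm{LW}}(i,j)=z_{\overline{u}}^{T}(i,j)\,(\mathcal{L}_{\overline{vu}})^{-1}\,z_{\overline{v}}(i,j)\quad\text{for all } u,v\in V,$$ where $\mathcal{L}^{-}$ is any g-inverse of $\mathcal{L}$, and $z(i,j)$ is the $n$-vector whose $i$th element is $1/p'_i$, whose $j$th element is $-1/p'_j$, and whose other elements are $0$.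
   Context: Weighted adjacency matrix: for vertices $i,j\in V$, let $n_{ij}\in\{0,1,\ldots\}$ be the number of edges incident to both $i$ and $j$ in $G$ (loops are allowed, so $n_{ii}$ may be positive), and let $w_{ij}^q>0$, $q=1,\ldots,n_{ij}$, be the weights of these edges. Then $A=(a_{ij})_{n\times n}$ with $a_{ij}=\sum_{q=1}^{n_{ij}}w_{ij}^q$ (and $a_{ij}=0$ if $n_{ij}=0$); $A$ is symmetric, entrywise nonnegative, and irreducible because $G$ is connected. All matrix and vector entries are indexed by the vertices of $G$. Perron vector: $p$ is a positive eigenvector of $A$ corresponding to the simple eigenvalue $\rho$ (unique up to a positive factor); $\|p\|_2=(\sum_{i=1}^n p_i^2)^{1/2}$. Long walk distance: for $0<t<\rho^{-1}$, let $R_t=(r_{ij}(t))_{n\times n}=\sum_{k=0}^\infty (tA)^k=(I-tA)^{-1}$, which is an entrywise positive matrix. The long walk distance is $$d^{\mathrm{LW}}(i,j)=\lim_{t\to(\rho^{-1})^-}\frac{\ln r_{ii}(t)+\ln r_{jj}(t)-2\ln r_{ij}(t)}{n\rho^2(\rho^{-1}-t)},\quad i,j\in V;$$ it is known that this limit always exists and is a metric on $V$. Notation: $X_{\overline{uv}}$ is the matrix $X$ with row $u$ and column $v$ removed (the remaining rows and columns keep their vertex labels, so $(\mathcal{L}_{\overline{ii}})_{\overline{jj}}$ is $\mathcal{L}$ with rows $i,j$ and columns $i,j$ removed; the determinant of the empty matrix, occurring when $n=2$, is $1$). For a vector $z$, $z_{\overline{u}}$ is $z$ with its entry indexed by $u$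 removed. A matrix $Z$ is a g-inverse of $X$ whenever $XZX=X$. *)

theory Defs
  imports "Jordan_Normal_Form.Spectral_Radius"
begin

text \<open>
  The vertices of a graph on n vertices are the numbers 0, \<dots>, n - 1, so that they serve
  directly as indices of matrices and vectors. An edge e has the set of its endpoints ends e
  (a singleton for a loop) and a positive weight w e; parallel edges are distinct members
  of E with the same set of endpoints.
\<close>

locale weighted_multigraph =
  fixes n :: nat and E :: "'e set" and ends :: "'e \<Rightarrow> nat set" and w :: "'e \<Rightarrow> real"
  assumes finite_edges: "finite E"
    and edge_ends: "e \<in> E \<Longrightarrow> \<exists>i<n. \<exists>j<n. ends e = {i, j}"
    and weight_pos: "e \<in> E \<Longrightarrow> w e > 0"

definition adjacency_rel :: "'e set \<Rightarrow> ('e \<Rightarrow> nat set) \<Rightarrow> (nat \<times> nat) set" where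
  "adjacency_rel E ends = {(i, j). \<exists>e\<in>E. ends e = {i, j}}"

locale connected_weighted_multigraph = weighted_multigraph n E ends w
  for n :: nat and E :: "'e set" and ends :: "'e \<Rightarrow> nat set" and w :: "'e \<Rightarrow> real" +
  assumes connected: "i < n \<Longrightarrow> j < n \<Longrightarrow> (i, j) \<in> (adjacency_rel E ends)\<^sup>*"

text \<open>A loop at i contributes its weight once to the diagonal entry at i.\<close>

definition weighted_adjacency_mat ::
    "nat \<Rightarrow> 'e set \<Rightarrow> ('e \<Rightarrow> nat set) \<Rightarrow> ('e \<Rightarrow> real) \<Rightarrow> real mat" where
  "weighted_adjacency_mat n E ends w =
     mat n n (\<lambda>(i, j). \<Sum>e\<in>{e \<in> E. ends e = {i, j}}. w e)"

definition spec_rad :: "real mat \<Rightarrow> real" where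
  "spec_rad A = spectral_radius (map_mat complex_of_real A)"

definition perron_vector :: "real mat \<Rightarrow> real vec \<Rightarrow> bool" where
  "perron_vector A p \<longleftrightarrow> eigenvector A p (spec_rad A) \<and> (\<forall>i<dim_row A. p $ i > 0)"

definition vec_norm2 :: "real vec \<Rightarrow> real" where
  "vec_norm2 v = sqrt (\<Sum>i<dim_vec v. (v $ i)\<^sup>2)"

definition laplacian_like :: "real mat \<Rightarrow> real mat" where
  "laplacian_like A = spec_rad A \<cdot>\<^sub>m 1\<^sub>m (dim_row A) - A"

definition walk_mat :: "real mat \<Rightarrow> real \<Rightarrow> real mat" where
  "walk_mat A t =
     mat (dim_row A) (dim_row A) (\<lambda>(i, j). \<Sum>k. ((t \<cdot>\<^sub>m A) ^\<^sub>m k) $$ (i, j))"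

definition long_walk_dist :: "real mat \<Rightarrow> nat \<Rightarrow> nat \<Rightarrow> real" where
  "long_walk_dist A i j =
     Lim (at_left (1 / spec_rad A))
       (\<lambda>t. (ln (walk_mat A t $$ (i, i)) + ln (walk_mat A t $$ (j, j))
              - 2 * ln (walk_mat A t $$ (i, j)))
            / (real (dim_row A) * (spec_rad A)\<^sup>2 * (1 / spec_rad A - t)))"

definition vec_delete :: "'a vec \<Rightarrow> nat \<Rightarrow> 'a vec" where
  "vec_delete v u = vec (dim_vec v - 1) (\<lambda>k. v $ insert_index u k)"

text \<open>
  Rows and columns of a matrix are renumbered by \<^const>\<open>mat_delete\<close>: once the row and column
  of i are gone, the vertex j \<noteq> i has position \<^term>\<open>delete_index i j\<close>.
\<close>

definition mat_delete_both :: "'a mat \<Rightarrow> nat \<Rightarrow> nat \<Rightarrow> 'a mat" where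
  "mat_delete_both X i j =
     mat_delete (mat_delete X i i) (delete_index i j) (delete_index i j)"

definition g_inverse :: "'a :: semiring_1 mat \<Rightarrow> 'a mat \<Rightarrow> bool" where
  "g_inverse X Z \<longleftrightarrow> Z \<in> carrier_mat (dim_col X) (dim_row X) \<and> X * Z * X = X"

definition z_vec :: "real vec \<Rightarrow> nat \<Rightarrow> nat \<Rightarrow> real vec" where
  "z_vec q i j =
     vec (dim_vec q) (\<lambda>k. if k = i then 1 / q $ i else if k = j then - (1 / q $ j) else 0)"

end

theory Submission
  imports Defs
begin

text \<open>
  Normalize the Perron vector to q = p' with q \<bullet> q = n and write L = \<rho> I - A. The kernel of L
  is spanned by q (\<open>kernel_L\<close>, a maximum principle), and as L is symmetric its range is the
  orthogonal complement of q (\<open>range_L\<close>). The vector z = z(i, j) is orthogonal to q, so L y = z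
  has a solution y, unique up to multiples of q. All three formulas say that the distance
  is z \<bullet> y.

  Why the distance is z \<bullet> y: put \<epsilon> = (1 - t \<rho>) / t = 1/t - \<rho>, so that I - t A = t (L + \<epsilon> I).
  The matrix H = (1 - t \<rho>) R = \<epsilon> (L + \<epsilon> I)^(-1) is nonnegative and fixes q, which bounds its
  entries uniformly in t. Together with H (L x) = \<epsilon> (x - H x) this yields the first-order
  expansion H_kl = q_k q_l / n + \<epsilon> (X_kl + o(1)), where column l of X is the
  solution of L x = e_l - (q_l / n) q orthogonal to q. In
  ln r_ii + ln r_jj - 2 ln r_ij the leading terms cancel, and the terms of order \<epsilon>, divided
  by the prescribed denominator n \<rho> (1 - t \<rho>), leave
  X_ii / q_i^2 + X_jj / q_j^2 - 2 X_ij / (q_i q_j), which is z \<bullet> y for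
  y = X z (\<open>ln_walk_tendsto\<close>, \<open>long_walk_tendsto\<close>).

  Given this, a g-inverse Z yields z \<bullet> Z z = y \<bullet> L Z L y = y \<bullet> L y = y \<bullet> z. For the
  inverse of L without row v and column u, choose the solution y with y_u = 0: deleting its
  entry u loses nothing, so the deleted inverse maps z without entry v to y without
  entry u (\<open>scalar_deleted_inverse\<close>). The determinant formula is the case u = v = i, where
  z without entry i has a single nonzero entry - 1 / q_j, so that only one diagonal cofactor
  of the deleted matrix is involved.
\<close>

section \<open>Preliminaries\<close>

lemma scalar_prod_sum: "y \<in> carrier_vec n \<Longrightarrow> x \<bullet> y = (\<Sum>k<n. x $ k * y $ k)"
  by (auto simp: scalar_prod_def lessThan_atLeast0)

lemma mult_mat_vec_sum:
  assumes "M \<in> carrier_mat m n" "x \<in> carrier_vec n" "k < m"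
  shows "(M *\<^sub>v x) $ k = (\<Sum>l<n. M $$ (k, l) * x $ l)"
  using assms by (auto simp: scalar_prod_def lessThan_atLeast0 intro!: sum.cong)

lemma sum_insert_index:
  fixes f :: "nat \<Rightarrow> 'b :: comm_monoid_add"
  assumes "u < n"
  shows "(\<Sum>l<n - 1. f (insert_index u l)) = (\<Sum>l\<in>{..<n} - {u}. f l)"
proof -
  have "Suc (n - 1) = n" using assms by simp
  then have "insert_index u ` {..<n - 1} = {..<n} - {u}"
    using insert_index_image[of u "n - 1"] assms by (simp add: lessThan_atLeast0)
  then show ?thesis
    using sum.reindex[OF insert_index_inj_on[of u "{..<n - 1}"], of f] by simp
qed

lemma sum_insert_index_vanishing:
  fixes f :: "nat \<Rightarrow> 'b :: comm_monoid_add"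
  assumes "u < n" "f u = 0"
  shows "(\<Sum>l<n - 1. f (insert_index u l)) = (\<Sum>l<n. f l)"
  unfolding sum_insert_index[OF assms(1)] using assms
  by (intro sum.mono_neutral_left) auto

lemma insert_index_less: "k < n - 1 \<Longrightarrow> insert_index u k < n"
  by (auto simp: insert_index_def)

lemma vec_delete_carrier [simp]: "x \<in> carrier_vec n \<Longrightarrow> vec_delete x u \<in> carrier_vec (n - 1)"
  by (auto simp: vec_delete_def)

lemma vec_delete_index: "x \<in> carrier_vec n \<Longrightarrow> k < n - 1 \<Longrightarrow> vec_delete x u $ k = x $ insert_index u k"
  by (auto simp: vec_delete_def)

lemma scalar_prod_vec_delete:
  fixes x y :: "'a :: semiring_0 vec"
  assumes "x \<in> carrier_vec n" "y \<in> carrier_vec n" "u < n" "y $ u = 0"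
  shows "vec_delete x u \<bullet> vec_delete y u = x \<bullet> y"
  using sum_insert_index_vanishing[of u n "\<lambda>l. x $ l * y $ l"] assms
  by (simp add: scalar_prod_def vec_delete_def lessThan_atLeast0)

text \<open>
  Column u contributes nothing to M y when y vanishes at u, so deleting it together with
  that entry of y commutes with the multiplication.
\<close>

lemma mat_delete_mult_vec_delete:
  fixes M :: "'a :: semiring_0 mat"
  assumes "M \<in> carrier_mat n n" "y \<in> carrier_vec n" "u < n" "v < n" "y $ u = 0"
  shows "mat_delete M v u *\<^sub>v vec_delete y u = vec_delete (M *\<^sub>v y) v"
proof (rule eq_vecI)
  fix k assume "k < dim_vec (vec_delete (M *\<^sub>v y) v)"
  then have k: "k < n - 1" using assms by (simp add: vec_delete_def)
  have "Suc (n - 1) = n" using assms by simp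
  then have entry: "mat_delete M v u $$ (k, l) = M $$ (insert_index v k, insert_index u l)"
    if "l < n - 1" for l
    using mat_delete_index[of M "n - 1" v u k l] assms k that by simp
  have "(mat_delete M v u *\<^sub>v vec_delete y u) $ k
      = (\<Sum>l<n - 1. M $$ (insert_index v k, insert_index u l) * y $ insert_index u l)"
    using mult_mat_vec_sum[OF mat_delete_carrier[OF assms(1)] vec_delete_carrier[OF assms(2)] k, of v u] assms(2)
    by (auto simp: entry vec_delete_index[of _ n])
  also have "\<dots> = (\<Sum>l<n. M $$ (insert_index v k, l) * y $ l)"
    using assms by (intro sum_insert_index_vanishing) auto
  also have "\<dots> = vec_delete (M *\<^sub>v y) v $ k"
    using assms k mult_mat_vec_sum[of M n n y "insert_index v k"]
    by (simp add: vec_delete_index[of _ n] insert_index_less)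
  finally show "(mat_delete M v u *\<^sub>v vec_delete y u) $ k = vec_delete (M *\<^sub>v y) v $ k" .
qed (use assms in \<open>simp add: vec_delete_def\<close>)

lemma det_nonzero_inverse:
  fixes M :: "'a :: field mat"
  assumes M: "M \<in> carrier_mat m m" and det: "det M \<noteq> 0"
  defines "B \<equiv> (1 / det M) \<cdot>\<^sub>m adj_mat M"
  shows "inverts_mat M B" "inverts_mat B M" "invertible_mat M"
proof -
  show 1: "inverts_mat M B"
    using adj_mat[OF M] M det
    by (auto simp: inverts_mat_def B_def mult_smult_distrib[OF M] intro!: eq_matI)
  show 2: "inverts_mat B M"
    using adj_mat[OF M] M det
    by (auto simp: inverts_mat_def B_def mult_smult_assoc_mat[where nr=m and n=m and nc=m]
        intro!: eq_matI)
  show "invertible_mat M"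
    using 1 2 M by (auto simp: invertible_mat_def)
qed

section \<open>A Perron eigenpair and its singular matrix\<close>

text \<open>
  The normalization of q makes q q^T / n the orthogonal projection onto the kernel of \<rho> I - A,
  the leading term of the scaled walk matrix.
\<close>

locale perron_eigenpair =
  fixes n :: nat and A :: "real mat" and rho :: real and q :: "real vec"
  assumes A: "A \<in> carrier_mat n n"
    and symmetric: "i < n \<Longrightarrow> j < n \<Longrightarrow> A $$ (i, j) = A $$ (j, i)"
    and nonneg: "i < n \<Longrightarrow> j < n \<Longrightarrow> A $$ (i, j) \<ge> 0"
    and irreducible: "i < n \<Longrightarrow> j < n \<Longrightarrow>
      (i, j) \<in> {(k, l). k < n \<and> l < n \<and> A $$ (k, l) > 0}\<^sup>*"
    and q: "q \<in> carrier_vec n"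
    and q_pos: "i < n \<Longrightarrow> q $ i > 0"
    and eigen: "A *\<^sub>v q = rho \<cdot>\<^sub>v q"
    and q_norm: "q \<bullet> q = real n"
    and n_gt_1: "n > 1"
begin

definition L :: "real mat" where
  "L = rho \<cdot>\<^sub>m 1\<^sub>m n - A"

lemma L [simp]: "L \<in> carrier_mat n n"
  using A unfolding L_def by (intro minus_carrier_mat)

lemma L_mult: "x \<in> carrier_vec n \<Longrightarrow> L *\<^sub>v x = rho \<cdot>\<^sub>v x - A *\<^sub>v x"
  using A unfolding L_def by (subst minus_mult_distrib_mat_vec[of _ n n]) auto

lemma scalar_L:
  assumes "x \<in> carrier_vec n" "y \<in> carrier_vec n"
  shows "x \<bullet> (L *\<^sub>v y) = (L *\<^sub>v x) \<bullet> y"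
proof -
  have "L\<^sup>T = L" unfolding L_def
    using A by (intro eq_matI) (auto simp: symmetric)
  then show ?thesis
    using transpose_vec_mult_scalar[OF L assms(2,1)] assms
    by (metis L comm_scalar_prod mult_mat_vec_carrier)
qed

lemma L_q: "L *\<^sub>v q = 0\<^sub>v n"
  using L_mult[OF q] eigen q by auto

lemma L_smult_q: "L *\<^sub>v (c \<cdot>\<^sub>v q) = 0\<^sub>v n"
  using mult_mat_vec[OF L q] L_q by auto

lemma q_scalar_L: "x \<in> carrier_vec n \<Longrightarrow> q \<bullet> (L *\<^sub>v x) = 0"
  using scalar_L[OF q] L_q by auto

lemma L_mult_add_smult_q:
  assumes "y \<in> carrier_vec n"
  shows "L *\<^sub>v (y + c \<cdot>\<^sub>v q) = L *\<^sub>v y"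
proof -
  have "L *\<^sub>v (y + c \<cdot>\<^sub>v q) = L *\<^sub>v y + L *\<^sub>v (c \<cdot>\<^sub>v q)"
    using assms q by (intro mult_add_distrib_mat_vec[OF L]) auto
  then show ?thesis using assms L_smult_q[of c] by (simp add: mult_mat_vec_carrier[OF L])
qed

lemma row_eigen: "i < n \<Longrightarrow> (\<Sum>l<n. A $$ (i, l) * q $ l) = rho * q $ i"
  using mult_mat_vec_sum[OF A q, of i] eigen q by auto

lemma rho_pos: "rho > 0"
proof -
  have "(0, 1) \<in> {(k, l). k < n \<and> l < n \<and> A $$ (k, l) > 0}\<^sup>*"
    using irreducible n_gt_1 by auto
  then obtain l where l: "l < n" "A $$ (0, l) > 0"
    by (auto elim: converse_rtranclE)
  have "(\<Sum>k<n. A $$ (0, k) * q $ k) > 0"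
    using l n_gt_1 q_pos nonneg by (intro sum_pos2[of _ l]) (auto simp: less_imp_le)
  then show ?thesis
    using row_eigen[of 0] q_pos[of 0] n_gt_1 by (auto simp: zero_less_mult_iff)
qed

text \<open>
  Subtract from x the largest multiple c of q that leaves a nonnegative vector d. It vanishes at
  some vertex, and at such a vertex the equation A d = \<rho> d says that a sum of nonnegative terms
  is zero. Hence d vanishes at all neighbours too, and by irreducibility everywhere.
\<close>

lemma kernel_L:
  assumes x: "x \<in> carrier_vec n" and Lx: "L *\<^sub>v x = 0\<^sub>v n"
  obtains c where "x = c \<cdot>\<^sub>v q"
proof
  define c where "c = Min ((\<lambda>k. x $ k / q $ k) ` {..<n})"
  define d where "d k = x $ k - c * q $ k" for k
  have fin: "finite ((\<lambda>k. x $ k / q $ k) ` {..<n})" "(\<lambda>k. x $ k / q $ k) ` {..<n} \<noteq> {}"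
    using n_gt_1 by auto
  have d_nonneg: "d k \<ge> 0" if "k < n" for k
  proof -
    have "c \<le> x $ k / q $ k" using that fin unfolding c_def by (intro Min_le) auto
    then show ?thesis using q_pos[OF that] by (simp add: d_def field_simps)
  qed
  have "c \<in> (\<lambda>k. x $ k / q $ k) ` {..<n}" unfolding c_def using fin by (rule Min_in)
  then obtain k0 where k0: "k0 < n" "d k0 = 0"
    using q_pos by (force simp: d_def)
  have row: "(\<Sum>l<n. A $$ (k, l) * d l) = rho * d k" if "k < n" for k
  proof -
    have "(L *\<^sub>v x) $ k = 0" using Lx that by simp
    then have "(\<Sum>l<n. A $$ (k, l) * x $ l) = rho * x $ k"
      using L_mult[OF x] mult_mat_vec_sum[OF A x that] that x A by simp
    moreover have "(\<Sum>l<n. A $$ (k, l) * d l)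
        = (\<Sum>l<n. A $$ (k, l) * x $ l) - c * (\<Sum>l<n. A $$ (k, l) * q $ l)"
      by (simp add: d_def sum_subtractf sum_distrib_left algebra_simps)
    ultimately show ?thesis using row_eigen[OF that] by (simp add: d_def algebra_simps)
  qed
  have step: "d l = 0" if kl: "k < n" "l < n" "A $$ (k, l) > 0" and dk: "d k = 0" for k l
  proof -
    have "(\<Sum>l<n. A $$ (k, l) * d l) = 0" using row[OF kl(1)] dk by simp
    then have "\<forall>l\<in>{..<n}. A $$ (k, l) * d l = 0"
      using kl(1) nonneg d_nonneg by (subst (asm) sum_nonneg_eq_0_iff) auto
    then have "A $$ (k, l) * d l = 0" using kl by blast
    then show ?thesis using kl by simp
  qed
  have "d l = 0" if "l < n" for l
    using irreducible[OF k0(1) that]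
    by (induction rule: rtrancl_induct) (use k0 step in auto)
  then show "x = c \<cdot>\<^sub>v q" using x q by (intro eq_vecI) (auto simp: d_def)
qed

text \<open>
  The rank-one matrix q q^T acts on the kernel of L only, so L + q q^T is invertible; for right-hand
  sides orthogonal to q its solution is orthogonal to q and solves the equation for L itself.
\<close>

lemma range_L:
  assumes x: "x \<in> carrier_vec n" and qx: "q \<bullet> x = 0"
  obtains y where "y \<in> carrier_vec n" "L *\<^sub>v y = x"
proof -
  define J where "J = mat n n (\<lambda>(k, l). q $ k * q $ l)"
  have J: "J \<in> carrier_mat n n" by (simp add: J_def)
  have J_mult: "J *\<^sub>v y = (q \<bullet> y) \<cdot>\<^sub>v q" if "y \<in> carrier_vec n" for y
  proof (rule eq_vecI)
    fix k assume "k < dim_vec ((q \<bullet> y) \<cdot>\<^sub>v q)"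
    then have k: "k < n" using q by simp
    have "(J *\<^sub>v y) $ k = (\<Sum>l<n. q $ k * q $ l * y $ l)"
      using mult_mat_vec_sum[OF J that k] k by (simp add: J_def)
    also have "\<dots> = (q \<bullet> y) * q $ k"
      using that q by (simp add: scalar_prod_def lessThan_atLeast0 sum_distrib_left sum_distrib_right mult_ac)
    finally show "(J *\<^sub>v y) $ k = ((q \<bullet> y) \<cdot>\<^sub>v q) $ k" using k q by simp
  qed (use J q in auto)
  have LJ: "L + J \<in> carrier_mat n n" using J by simp
  have LJ_mult: "(L + J) *\<^sub>v y = L *\<^sub>v y + (q \<bullet> y) \<cdot>\<^sub>v q" if "y \<in> carrier_vec n" for y
    using add_mult_distrib_mat_vec[OF L J that] J_mult[OF that] by simp
  have LJ_perp: "(L + J) *\<^sub>v y = L *\<^sub>v y" if "y \<in> carrier_vec n" "q \<bullet> y = 0" for y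
    unfolding LJ_mult[OF that(1)] that(2)
    using q carrier_matD[OF L] by (intro eq_vecI) auto
  have q_LJ: "q \<bullet> ((L + J) *\<^sub>v y) = (q \<bullet> y) * real n" if "y \<in> carrier_vec n" for y
    unfolding LJ_mult[OF that]
    using that q q_norm q_scalar_L[OF that]
    by (subst scalar_prod_add_distrib[of _ n]) (auto simp: mult_mat_vec_carrier[OF L])
  have "det (L + J) \<noteq> 0"
  proof
    assume "det (L + J) = 0"
    then obtain y where y: "y \<in> carrier_vec n" "y \<noteq> 0\<^sub>v n" "(L + J) *\<^sub>v y = 0\<^sub>v n"
      using det_0_iff_vec_prod_zero[OF LJ] by auto
    have qy: "q \<bullet> y = 0" using q_LJ[OF y(1)] y(3) q n_gt_1 by auto
    then have "L *\<^sub>v y = 0\<^sub>v n" using LJ_perp[OF y(1)] y(3) by simp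
    then obtain c where c: "y = c \<cdot>\<^sub>v q" using kernel_L y(1) by blast
    then have "c = 0" using qy q q_norm n_gt_1 by auto
    then show False using c y q by auto
  qed
  note inv = det_nonzero_inverse(1)[OF LJ this]
  define y where "y = ((1 / det (L + J)) \<cdot>\<^sub>m adj_mat (L + J)) *\<^sub>v x"
  have B: "(1 / det (L + J)) \<cdot>\<^sub>m adj_mat (L + J) \<in> carrier_mat n n" using adj_mat[OF LJ] by simp
  have y: "y \<in> carrier_vec n" unfolding y_def using B x by (rule mult_mat_vec_carrier)
  have LJy: "(L + J) *\<^sub>v y = x"
    unfolding y_def assoc_mult_mat_vec[OF LJ B x, symmetric]
    using inv LJ x J by (simp add: inverts_mat_def)
  then have "q \<bullet> y = 0" using q_LJ[OF y] qx n_gt_1 by simp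
  then have "L *\<^sub>v y = x" using LJ_perp[OF y] LJy by simp
  then show thesis using y that by blast
qed

section \<open>The walk matrix near the critical parameter\<close>

context
  fixes t :: real
  assumes t: "0 < t" "t * rho < 1"
begin

lemma tA: "t \<cdot>\<^sub>m A \<in> carrier_mat n n"
  using A by simp

lemma walk_mat: "walk_mat A t \<in> carrier_mat n n"
  using A by (simp add: walk_mat_def)

lemma tA_mult: "x \<in> carrier_vec n \<Longrightarrow> (t \<cdot>\<^sub>m A) *\<^sub>v x = t \<cdot>\<^sub>v (A *\<^sub>v x)"
  using A by (intro eq_vecI) (auto simp: smult_scalar_prod_distrib[of _ n])

lemma pow_Suc_mult:
  assumes "x \<in> carrier_vec n"
  shows "((t \<cdot>\<^sub>m A) ^\<^sub>m Suc k) *\<^sub>v x = ((t \<cdot>\<^sub>m A) ^\<^sub>m k) *\<^sub>v ((t \<cdot>\<^sub>m A) *\<^sub>v x)"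
  using assoc_mult_mat_vec[OF pow_carrier_mat[OF tA] tA assms, of k] by simp

lemma pow_mult_q: "((t \<cdot>\<^sub>m A) ^\<^sub>m k) *\<^sub>v q = (t * rho) ^ k \<cdot>\<^sub>v q"
proof (induction k)
  case 0
  then show ?case using A q by simp
next
  case (Suc k)
  have "(t \<cdot>\<^sub>m A) *\<^sub>v q = (t * rho) \<cdot>\<^sub>v q"
    using tA_mult[OF q] eigen by (simp add: smult_smult_assoc)
  then show ?case
    unfolding pow_Suc_mult[OF q]
    using Suc mult_mat_vec[OF pow_carrier_mat[OF tA] q, of k "t * rho"]
    by (simp add: smult_smult_assoc)
qed

lemma pow_nonneg: "i < n \<Longrightarrow> j < n \<Longrightarrow> ((t \<cdot>\<^sub>m A) ^\<^sub>m k) $$ (i, j) \<ge> 0"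
proof (induction k arbitrary: j)
  case 0
  then show ?case using A by simp
next
  case (Suc k)
  have "0 \<le> ((t \<cdot>\<^sub>m A) ^\<^sub>m k) $$ (i, l) * (t \<cdot>\<^sub>m A) $$ (l, j)" if "l < n" for l
    using Suc that nonneg[of l j] t A by (intro mult_nonneg_nonneg) auto
  then show ?case
    using Suc.prems A by (auto simp: scalar_prod_def intro!: sum_nonneg)
qed

text \<open>
  Since (t A)^k q = (t \<rho>)^k q and all terms are nonnegative, each entry of (t A)^k is
  dominated by a geometric sequence.
\<close>

lemma walk_summable:
  assumes "i < n" "j < n"
  shows "summable (\<lambda>k. ((t \<cdot>\<^sub>m A) ^\<^sub>m k) $$ (i, j))"
proof (rule summable_comparison_test')
  show "summable (\<lambda>k. q $ i / q $ j * (t * rho) ^ k)"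
    using t rho_pos by (intro summable_mult summable_geometric) auto
  fix k
  let ?P = "(t \<cdot>\<^sub>m A) ^\<^sub>m k"
  have "?P $$ (i, j) * q $ j \<le> (\<Sum>l<n. ?P $$ (i, l) * q $ l)"
    using assms pow_nonneg q_pos
    by (intro member_le_sum[of j "{..<n}" "\<lambda>l. ?P $$ (i, l) * q $ l"]) (auto simp: less_imp_le)
  also have "\<dots> = (t * rho) ^ k * q $ i"
    using mult_mat_vec_sum[OF pow_carrier_mat[OF tA] q assms(1), of k] pow_mult_q assms q by simp
  finally show "norm (?P $$ (i, j)) \<le> q $ i / q $ j * (t * rho) ^ k"
    using pow_nonneg[OF assms, of k] q_pos[OF assms(2)] by (simp add: field_simps)
qed

lemma walk_nonneg: "i < n \<Longrightarrow> j < n \<Longrightarrow> walk_mat A t $$ (i, j) \<ge> 0"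
  using A pow_nonneg walk_summable by (auto simp: walk_mat_def intro!: suminf_nonneg)

lemma walk_mult_sums:
  assumes "x \<in> carrier_vec n" "i < n"
  shows "(\<lambda>k. (((t \<cdot>\<^sub>m A) ^\<^sub>m k) *\<^sub>v x) $ i) sums (walk_mat A t *\<^sub>v x) $ i"
proof -
  have "(\<lambda>k. \<Sum>l<n. ((t \<cdot>\<^sub>m A) ^\<^sub>m k) $$ (i, l) * x $ l) sums
      (\<Sum>l<n. walk_mat A t $$ (i, l) * x $ l)"
    using assms A summable_sums[OF walk_summable]
    by (intro sums_sum sums_mult2) (auto simp: walk_mat_def)
  then show ?thesis
    using mult_mat_vec_sum[OF walk_mat assms] mult_mat_vec_sum[OF pow_carrier_mat[OF tA] assms] by simp
qed

text \<open>The walk matrix is the Neumann series of I - t A; applied to (I - t A) x it telescopes.\<close>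

lemma walk_mat_resolvent:
  assumes "x \<in> carrier_vec n"
  shows "walk_mat A t *\<^sub>v (x - (t \<cdot>\<^sub>m A) *\<^sub>v x) = x"
proof (rule eq_vecI)
  let ?P = "\<lambda>k. (t \<cdot>\<^sub>m A) ^\<^sub>m k"
  fix i assume "i < dim_vec x"
  then have i: "i < n" using assms by simp
  have y: "(t \<cdot>\<^sub>m A) *\<^sub>v x \<in> carrier_vec n" using tA assms by (rule mult_mat_vec_carrier)
  have "(?P k *\<^sub>v (x - (t \<cdot>\<^sub>m A) *\<^sub>v x)) $ i = (?P k *\<^sub>v x) $ i - (?P (Suc k) *\<^sub>v x) $ i" for k
    unfolding mult_minus_distrib_mat_vec[OF pow_carrier_mat[OF tA] assms y] pow_Suc_mult[OF assms]
    using i A by (subst index_minus_vec) auto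
  moreover have "(\<lambda>k. (?P k *\<^sub>v x) $ i) \<longlonglongrightarrow> 0"
    using walk_mult_sums[OF assms i] sums_summable summable_LIMSEQ_zero by blast
  then have "(\<lambda>k. (?P k *\<^sub>v x) $ i - (?P (Suc k) *\<^sub>v x) $ i) sums ((?P 0 *\<^sub>v x) $ i - 0)"
    by (rule telescope_sums')
  ultimately have "(\<lambda>k. (?P k *\<^sub>v (x - (t \<cdot>\<^sub>m A) *\<^sub>v x)) $ i) sums x $ i"
    using A assms by simp
  moreover have "x - (t \<cdot>\<^sub>m A) *\<^sub>v x \<in> carrier_vec n" using assms y by simp
  note walk_mult_sums[OF this i]
  ultimately show "(walk_mat A t *\<^sub>v (x - (t \<cdot>\<^sub>m A) *\<^sub>v x)) $ i = x $ i"
    using sums_unique2 by blast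
qed (use walk_mat assms in simp)

text \<open>
  The scaling by 1 - t \<rho> removes the pole of the walk matrix at t = 1 / \<rho>: with
  \<epsilon> = (1 - t \<rho>) / t this is \<epsilon> (L + \<epsilon> I)^(-1).
\<close>

definition H :: "real mat" where
  "H = (1 - t * rho) \<cdot>\<^sub>m walk_mat A t"

lemma H: "H \<in> carrier_mat n n"
  using walk_mat by (simp add: H_def)

lemma H_mult: "x \<in> carrier_vec n \<Longrightarrow> H *\<^sub>v x = (1 - t * rho) \<cdot>\<^sub>v (walk_mat A t *\<^sub>v x)"
  using walk_mat by (intro eq_vecI) (auto simp: H_def smult_scalar_prod_distrib[of _ n])

text \<open>On the range of L, a further factor \<epsilon> = (1 - t \<rho>) / t splits off.\<close>

lemma H_L_mult:
  assumes x: "x \<in> carrier_vec n"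
  shows "H *\<^sub>v (L *\<^sub>v x) = ((1 - t * rho) / t) \<cdot>\<^sub>v (x - H *\<^sub>v x)"
proof -
  have Ax: "A *\<^sub>v x \<in> carrier_vec n" using A x by (rule mult_mat_vec_carrier)
  have "L *\<^sub>v x = (1 / t) \<cdot>\<^sub>v ((x - (t \<cdot>\<^sub>m A) *\<^sub>v x) - (1 - t * rho) \<cdot>\<^sub>v x)"
    unfolding L_mult[OF x] tA_mult[OF x] using x Ax t A
    by (intro eq_vecI) (auto simp: field_simps)
  then have "walk_mat A t *\<^sub>v (L *\<^sub>v x) = (1 / t) \<cdot>\<^sub>v (walk_mat A t *\<^sub>v ((x - (t \<cdot>\<^sub>m A) *\<^sub>v x) - (1 - t * rho) \<cdot>\<^sub>v x))"
    using x Ax tA_mult[OF x] by (simp add: mult_mat_vec[OF walk_mat])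
  also have "\<dots> = (1 / t) \<cdot>\<^sub>v (x - (1 - t * rho) \<cdot>\<^sub>v (walk_mat A t *\<^sub>v x))"
    using x Ax tA_mult[OF x] walk_mat_resolvent[OF x]
    by (subst mult_minus_distrib_mat_vec[OF walk_mat]) (auto simp: mult_mat_vec[OF walk_mat])
  finally have "walk_mat A t *\<^sub>v (L *\<^sub>v x) = (1 / t) \<cdot>\<^sub>v (x - H *\<^sub>v x)"
    using H_mult[OF x] by simp
  then show ?thesis
    using H_mult[OF mult_mat_vec_carrier[OF L x]] by (simp add: smult_smult_assoc)
qed

lemma H_q: "H *\<^sub>v q = q"
proof -
  have "H *\<^sub>v (L *\<^sub>v q) = 0\<^sub>v n" unfolding L_q using H by auto
  then have eq: "((1 - t * rho) / t) \<cdot>\<^sub>v (q - H *\<^sub>v q) = 0\<^sub>v n" using H_L_mult[OF q] by simp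
  show ?thesis
  proof (rule eq_vecI)
    fix k assume k: "k < dim_vec q"
    then have "(((1 - t * rho) / t) \<cdot>\<^sub>v (q - H *\<^sub>v q)) $ k = 0" using eq q by simp
    then show "(H *\<^sub>v q) $ k = q $ k" using k t q H by auto
  qed (use H q in auto)
qed

text \<open>
  A nonnegative matrix that fixes the positive vector q has entries bounded in terms of q alone;
  it is this uniformity in t that makes the limits below elementary.
\<close>

lemma H_bounds:
  assumes "i < n" "j < n"
  shows "0 \<le> H $$ (i, j)" "H $$ (i, j) \<le> q $ i / q $ j"
proof -
  have nn: "0 \<le> H $$ (i, l)" if "l < n" for l
    using walk_nonneg[OF assms(1) that] t walk_mat assms that by (simp add: H_def)
  then show "0 \<le> H $$ (i, j)" using assms by simp
  have "H $$ (i, j) * q $ j \<le> (\<Sum>l<n. H $$ (i, l) * q $ l)"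
    using assms nn q_pos
    by (intro member_le_sum[of j "{..<n}" "\<lambda>l. H $$ (i, l) * q $ l"]) (auto simp: less_imp_le)
  also have "\<dots> = q $ i"
    using mult_mat_vec_sum[OF H q assms(1)] H_q by simp
  finally show "H $$ (i, j) \<le> q $ i / q $ j"
    using q_pos[OF assms(2)] by (simp add: field_simps)
qed

lemma H_mult_bound:
  assumes "x \<in> carrier_vec n" "i < n"
  shows "\<bar>(H *\<^sub>v x) $ i\<bar> \<le> (\<Sum>l<n. q $ i / q $ l * \<bar>x $ l\<bar>)"
proof -
  have "\<bar>\<Sum>l<n. H $$ (i, l) * x $ l\<bar> \<le> (\<Sum>l<n. \<bar>H $$ (i, l) * x $ l\<bar>)" by (rule sum_abs)
  also have "\<dots> \<le> (\<Sum>l<n. q $ i / q $ l * \<bar>x $ l\<bar>)"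
    using H_bounds assms by (intro sum_mono) (simp add: abs_mult mult_right_mono del: times_divide_eq_left)
  finally show ?thesis using mult_mat_vec_sum[OF H assms] by simp
qed

end


section \<open>The limit\<close>

lemma eventually_valid: "\<forall>\<^sub>F t in at_left (1 / rho). 0 < t \<and> t * rho < 1"
  using eventually_at_left_real[of 0 "1 / rho"] rho_pos
  by (auto simp: field_simps elim!: eventually_mono)

lemma eps_tendsto: "((\<lambda>t. (1 - t * rho) / t) \<longlongrightarrow> 0) (at_left (1 / rho))"
  using rho_pos by (auto intro!: tendsto_eq_intros)

text \<open>
  The first-order coefficient x of column j of H. Besides solving its equation it has to lie in
  the range of L, i.e. be orthogonal to q, so that H x tends to zero.
\<close>

lemma corrector:
  assumes "j < n"
  obtains x y where "y \<in> carrier_vec n" "x \<in> carrier_vec n" "L *\<^sub>v y = x"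
    "L *\<^sub>v x = unit_vec n j - (q $ j / real n) \<cdot>\<^sub>v q"
proof -
  let ?b = "unit_vec n j - (q $ j / real n) \<cdot>\<^sub>v q"
  have "q \<bullet> ?b = q \<bullet> unit_vec n j - q \<bullet> ((q $ j / real n) \<cdot>\<^sub>v q)"
    using q by (intro scalar_prod_minus_distrib[of _ n]) auto
  also have "\<dots> = 0" using q q_norm assms n_gt_1 by simp
  finally have qb: "q \<bullet> ?b = 0" .
  have "?b \<in> carrier_vec n" using q by simp
  from range_L[OF this qb] obtain x0 where x0: "x0 \<in> carrier_vec n" "L *\<^sub>v x0 = ?b" by blast
  \<comment> \<open>the component along q is removed, using \<^term>\<open>q \<bullet> q = real n\<close>\<close>
  define x where "x = x0 + (- (q \<bullet> x0) / real n) \<cdot>\<^sub>v q"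
  have x: "x \<in> carrier_vec n" using x0 q by (simp add: x_def)
  have Lx: "L *\<^sub>v x = ?b" using L_mult_add_smult_q[OF x0(1)] x0(2) by (simp add: x_def)
  have "q \<bullet> x = q \<bullet> x0 + q \<bullet> ((- (q \<bullet> x0) / real n) \<cdot>\<^sub>v q)"
    unfolding x_def using q x0 by (intro scalar_prod_add_distrib[of _ n]) auto
  also have "\<dots> = 0" using q q_norm n_gt_1 by simp
  finally have "q \<bullet> x = 0" .
  from range_L[OF x this] obtain y where "y \<in> carrier_vec n" "L *\<^sub>v y = x" by blast
  then show thesis using that x Lx by blast
qed

lemma H_mult_range_tendsto_0:
  assumes y: "y \<in> carrier_vec n" and i: "i < n"
  shows "((\<lambda>t. (H t *\<^sub>v (L *\<^sub>v y)) $ i) \<longlongrightarrow> 0) (at_left (1 / rho))"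
proof (rule tendsto_0_le[OF eps_tendsto])
  let ?C = "\<bar>y $ i\<bar> + (\<Sum>l<n. q $ i / q $ l * \<bar>y $ l\<bar>)"
  show "\<forall>\<^sub>F t in at_left (1 / rho). norm ((H t *\<^sub>v (L *\<^sub>v y)) $ i) \<le> norm ((1 - t * rho) / t) * ?C"
    using eventually_valid
  proof eventually_elim
    case (elim t)
    then have t: "0 < t" "t * rho < 1" by auto
    have "(H t *\<^sub>v (L *\<^sub>v y)) $ i = (1 - t * rho) / t * (y $ i - (H t *\<^sub>v y) $ i)"
      unfolding H_L_mult[OF t y] using H[OF t] y i by simp
    moreover have "\<bar>y $ i - (H t *\<^sub>v y) $ i\<bar> \<le> ?C"
      using H_mult_bound[OF t y i] by linarith
    ultimately show ?case by (simp add: abs_mult mult_left_mono del: times_divide_eq_left)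
  qed
qed

text \<open>
  Split the unit vector e_j into its component (q_j / n) q along q, which H fixes, and the
  remainder L x, from which H splits off a factor \<epsilon>.
\<close>

lemma H_entry:
  assumes t: "0 < t" "t * rho < 1" and i: "i < n" and j: "j < n"
    and x: "x \<in> carrier_vec n" and Lx: "L *\<^sub>v x = unit_vec n j - (q $ j / real n) \<cdot>\<^sub>v q"
  shows "H t $$ (i, j) = q $ i * q $ j / real n + (1 - t * rho) / t * (x $ i - (H t *\<^sub>v x) $ i)"
proof -
  have "H t *\<^sub>v (L *\<^sub>v x) = H t *\<^sub>v unit_vec n j - H t *\<^sub>v ((q $ j / real n) \<cdot>\<^sub>v q)"
    unfolding Lx using q by (intro mult_minus_distrib_mat_vec[OF H[OF t]]) auto
  also have "\<dots> = col (H t) j - (q $ j / real n) \<cdot>\<^sub>v q"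
    using H[OF t] j q mult_mat_vec[OF H[OF t] q] H_q[OF t]
    by (auto intro!: eq_vecI)
  finally have "(H t *\<^sub>v (L *\<^sub>v x)) $ i = H t $$ (i, j) - q $ i * q $ j / real n"
    using H[OF t] i j q by simp
  moreover have "(H t *\<^sub>v (L *\<^sub>v x)) $ i = (1 - t * rho) / t * (x $ i - (H t *\<^sub>v x) $ i)"
    unfolding H_L_mult[OF t x] using H[OF t] x i by simp
  ultimately show ?thesis by simp
qed

text \<open>
  By \<open>H_entry\<close>, the walk matrix entry is q_i q_j / (n (1 - t \<rho>)) times a factor
  1 + n \<epsilon> x_i / (q_i q_j) + o(\<epsilon>). The numerator is the logarithm of this factor. The terms
  subtracted here cancel in the combination that defines the distance.
\<close>

lemma ln_walk_tendsto:
  assumes i: "i < n" and j: "j < n"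
    and y: "y \<in> carrier_vec n" and x: "x \<in> carrier_vec n" "L *\<^sub>v y = x"
    and Lx: "L *\<^sub>v x = unit_vec n j - (q $ j / real n) \<cdot>\<^sub>v q"
  shows "((\<lambda>t. (ln (walk_mat A t $$ (i, j)) - ln (q $ i) - ln (q $ j) + ln (real n * (1 - t * rho)))
              / (real n * rho\<^sup>2 * (1 / rho - t)))
          \<longlongrightarrow> x $ i / (q $ i * q $ j)) (at_left (1 / rho))"
proof -
  let ?F = "at_left (1 / rho)"
  define K where "K t = (x $ i - (H t *\<^sub>v x) $ i) / (q $ i * q $ j)" for t
  define f where "f t = 1 + real n * ((1 - t * rho) / t * K t)" for t
  \<comment> \<open>the derivative of ln at 1 in factored form, which needs no case distinction for f t = 1\<close>
  obtain \<phi> :: "real \<Rightarrow> real" where \<phi>: "\<And>s. ln s = \<phi> s * (s - 1)" "isCont \<phi> 1" "\<phi> 1 = 1"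
    using DERIV_ln_divide[of "1 :: real"] unfolding CARAT_DERIV by auto
  have qij: "q $ i > 0" "q $ j > 0" using q_pos i j by auto
  have factor: "a / m + e * h = a / m * (1 + m * (e * (h / a)))" if "a \<noteq> 0" "m \<noteq> 0" for a m e h :: real
    using that by (simp add: field_simps)
  have cancel: "c * (m * (s / t * k)) / (m * r * s) = c * k / (t * r)"
    if "m \<noteq> 0" "s \<noteq> 0" "r \<noteq> 0" "t \<noteq> 0" for c m s t k r :: real
    using that by (simp add: field_simps)
  have K: "(K \<longlongrightarrow> x $ i / (q $ i * q $ j)) ?F"
    unfolding K_def using H_mult_range_tendsto_0[OF y i] x(2) qij by (auto intro!: tendsto_eq_intros)
  have f: "(f \<longlongrightarrow> 1) ?F"
    unfolding f_def by (rule tendsto_eq_intros K eps_tendsto refl)+ simp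
  have \<phi>f: "((\<lambda>t. \<phi> (f t)) \<longlongrightarrow> 1) ?F"
    using isCont_tendsto_compose[OF \<phi>(2) f] \<phi>(3) by simp
  have "((\<lambda>t. \<phi> (f t) * K t / (t * rho)) \<longlongrightarrow> x $ i / (q $ i * q $ j)) ?F"
    using rho_pos by (auto intro!: tendsto_eq_intros \<phi>f K)
  moreover have "\<forall>\<^sub>F t in ?F. f t > 0"
    using order_tendstoD(1)[OF f, of 0] by simp
  then have "\<forall>\<^sub>F t in ?F. \<phi> (f t) * K t / (t * rho)
      = (ln (walk_mat A t $$ (i, j)) - ln (q $ i) - ln (q $ j) + ln (real n * (1 - t * rho)))
          / (real n * rho\<^sup>2 * (1 / rho - t))"
    using eventually_valid
  proof eventually_elim
    case (elim t)
    then have t: "0 < t" "t * rho < 1" by auto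
    have "H t $$ (i, j) = q $ i * q $ j / real n * f t"
      unfolding H_entry[OF t i j x(1) Lx] f_def K_def
      by (rule factor) (use qij n_gt_1 in auto)
    then have "walk_mat A t $$ (i, j) = q $ i * q $ j * f t / (real n * (1 - t * rho))"
      using walk_mat[OF t] t i j by (simp add: H_def[OF t] field_simps)
    then have "ln (walk_mat A t $$ (i, j))
        = ln (q $ i) + ln (q $ j) + ln (f t) - ln (real n * (1 - t * rho))"
      using qij t n_gt_1 elim by (simp add: ln_div ln_mult)
    then have "(ln (walk_mat A t $$ (i, j)) - ln (q $ i) - ln (q $ j) + ln (real n * (1 - t * rho)))
          / (real n * rho\<^sup>2 * (1 / rho - t)) = ln (f t) / (real n * rho\<^sup>2 * (1 / rho - t))"
      by simp
    also have "\<dots> = \<phi> (f t) * (real n * ((1 - t * rho) / t * K t)) / (real n * rho\<^sup>2 * (1 / rho - t))"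
      unfolding \<phi>(1)[of "f t"] by (simp add: f_def)
    also have denom: "real n * rho\<^sup>2 * (1 / rho - t) = real n * rho * (1 - t * rho)"
      using rho_pos by (simp add: field_simps power2_eq_square)
    also have "\<phi> (f t) * (real n * ((1 - t * rho) / t * K t)) / (real n * rho * (1 - t * rho))
        = \<phi> (f t) * K t / (t * rho)"
      by (rule cancel) (use t n_gt_1 rho_pos in auto)
    finally show ?case unfolding denom by (rule sym)
  qed
  ultimately show ?thesis by (rule Lim_transform_eventually)
qed

lemma z_vec: "z_vec q i j \<in> carrier_vec n"
  using q by (simp add: z_vec_def)

lemma z_vec_eq:
  assumes "i < n" "j < n" "j \<noteq> i"
  shows "z_vec q i j = (1 / q $ i) \<cdot>\<^sub>v unit_vec n i - (1 / q $ j) \<cdot>\<^sub>v unit_vec n j"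
  using q assms by (intro eq_vecI) (auto simp: z_vec_def)

lemma z_scalar:
  assumes "i < n" "j < n" "j \<noteq> i" "y \<in> carrier_vec n"
  shows "z_vec q i j \<bullet> y = y $ i / q $ i - y $ j / q $ j"
  unfolding z_vec_eq[OF assms(1-3)] using assms
  by (subst minus_scalar_prod_distrib[of _ n]) auto

text \<open>
  The correctors of i and j combine to a particular solution y0 of L y0 = z for which z \<bullet> y0 is
  the limit. The choice of the solution is immaterial: by symmetry of L, z \<bullet> y = y0 \<bullet> L y = y0 \<bullet> z.
\<close>

lemma long_walk_tendsto:
  assumes ij: "i < n" "j < n" "j \<noteq> i"
    and y: "y \<in> carrier_vec n" "L *\<^sub>v y = z_vec q i j"
  shows "((\<lambda>t. (ln (walk_mat A t $$ (i, i)) + ln (walk_mat A t $$ (j, j))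
              - 2 * ln (walk_mat A t $$ (i, j))) / (real n * rho\<^sup>2 * (1 / rho - t)))
          \<longlongrightarrow> z_vec q i j \<bullet> y) (at_left (1 / rho))"
proof -
  obtain x1 y1 where 1: "y1 \<in> carrier_vec n" "x1 \<in> carrier_vec n" "L *\<^sub>v y1 = x1"
    "L *\<^sub>v x1 = unit_vec n i - (q $ i / real n) \<cdot>\<^sub>v q" using corrector[OF ij(1)] by blast
  obtain x2 y2 where 2: "y2 \<in> carrier_vec n" "x2 \<in> carrier_vec n" "L *\<^sub>v y2 = x2"
    "L *\<^sub>v x2 = unit_vec n j - (q $ j / real n) \<cdot>\<^sub>v q" using corrector[OF ij(2)] by blast
  have qij: "q $ i > 0" "q $ j > 0" using q_pos ij by auto
  have "q \<bullet> x1 = 0" "q \<bullet> x2 = 0" using q_scalar_L 1 2 by auto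
  then have orth: "x1 \<bullet> q = 0" "q \<bullet> x2 = 0" using comm_scalar_prod[OF q 1(2)] by auto
  \<comment> \<open>the two correctors form a symmetric matrix, which merges the mixed terms\<close>
  have "x1 \<bullet> (L *\<^sub>v x2) = x1 $ j"
    unfolding 2(4) using 1 2 q ij orth by (subst scalar_prod_minus_distrib[of _ n]) auto
  moreover have "(L *\<^sub>v x1) \<bullet> x2 = x2 $ i"
    unfolding 1(4) using 1 2 q ij orth by (subst minus_scalar_prod_distrib[of _ n]) auto
  ultimately have sym: "x1 $ j = x2 $ i" using scalar_L[OF 1(2) 2(2)] by simp
  define y0 where "y0 = (1 / q $ i) \<cdot>\<^sub>v x1 - (1 / q $ j) \<cdot>\<^sub>v x2"
  have y0: "y0 \<in> carrier_vec n" using 1 2 by (simp add: y0_def)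
  have "L *\<^sub>v y0 = (1 / q $ i) \<cdot>\<^sub>v (L *\<^sub>v x1) - (1 / q $ j) \<cdot>\<^sub>v (L *\<^sub>v x2)"
    unfolding y0_def using 1 2
    by (subst mult_minus_distrib_mat_vec[OF L]) (auto simp: mult_mat_vec[OF L])
  also have "\<dots> = z_vec q i j"
    unfolding 1(4) 2(4) z_vec_eq[OF ij] using q qij by (intro eq_vecI) (auto simp: field_simps)
  finally have Ly0: "L *\<^sub>v y0 = z_vec q i j" .
  have "z_vec q i j \<bullet> y = y0 \<bullet> z_vec q i j"
    using scalar_L[OF y0 y(1)] Ly0 y(2) by simp
  also have "\<dots> = z_vec q i j \<bullet> y0" using comm_scalar_prod[OF y0 z_vec] .
  also have "\<dots> = x1 $ i / (q $ i * q $ i) + x2 $ j / (q $ j * q $ j) - 2 * (x2 $ i / (q $ i * q $ j))"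
    unfolding z_scalar[OF ij y0] unfolding y0_def using 1 2 ij qij sym by (simp add: field_simps)
  finally have val: "z_vec q i j \<bullet> y = \<dots>" .
  let ?D = "\<lambda>t. real n * rho\<^sup>2 * (1 / rho - t)"
  let ?Q = "\<lambda>k l t. (ln (walk_mat A t $$ (k, l)) - ln (q $ k) - ln (q $ l) + ln (real n * (1 - t * rho))) / ?D t"
  have "((\<lambda>t. ?Q i i t + ?Q j j t - 2 * ?Q i j t) \<longlongrightarrow> z_vec q i j \<bullet> y) (at_left (1 / rho))"
    unfolding val
    by (intro tendsto_intros ln_walk_tendsto[OF ij(1) ij(1) 1] ln_walk_tendsto[OF ij(2) ij(2) 2]
        ln_walk_tendsto[OF ij(1) ij(2) 2])
  moreover have "?Q i i t + ?Q j j t - 2 * ?Q i j t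
      = (ln (walk_mat A t $$ (i, i)) + ln (walk_mat A t $$ (j, j)) - 2 * ln (walk_mat A t $$ (i, j))) / ?D t" for t
    by (simp add: add_divide_distrib diff_divide_distrib)
  ultimately show ?thesis by simp
qed

section \<open>Generalized inverses and deleted rows and columns\<close>

lemma z_equation_solution:
  assumes ij: "i < n" "j < n" "j \<noteq> i" and u: "u < n"
  obtains y where "y \<in> carrier_vec n" "L *\<^sub>v y = z_vec q i j" "y $ u = 0"
proof -
  have "z_vec q i j \<bullet> q = 0" using z_scalar[OF ij q] q_pos[OF ij(1)] q_pos[OF ij(2)] by simp
  then have "q \<bullet> z_vec q i j = 0" using comm_scalar_prod[OF q z_vec] by simp
  from range_L[OF z_vec this]
  obtain y where y: "y \<in> carrier_vec n" "L *\<^sub>v y = z_vec q i j" by blast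
  let ?y = "y + (- (y $ u) / q $ u) \<cdot>\<^sub>v q"
  have "?y \<in> carrier_vec n" using y q by simp
  moreover have "L *\<^sub>v ?y = z_vec q i j" using L_mult_add_smult_q[OF y(1)] y(2) by simp
  moreover have "?y $ u = 0" using y q u q_pos[OF u] by simp
  ultimately show thesis using that by blast
qed

lemma scalar_g_inverse:
  assumes Z: "g_inverse L Z" and y: "y \<in> carrier_vec n"
  shows "(L *\<^sub>v y) \<bullet> (Z *\<^sub>v (L *\<^sub>v y)) = (L *\<^sub>v y) \<bullet> y"
proof -
  have Zc: "Z \<in> carrier_mat n n" and LZL: "L * Z * L = L"
    using Z L by (auto simp: g_inverse_def simp del: L)
  have Ly: "L *\<^sub>v y \<in> carrier_vec n" using L y by (rule mult_mat_vec_carrier)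
  have ZLy: "Z *\<^sub>v (L *\<^sub>v y) \<in> carrier_vec n" using Zc Ly by (rule mult_mat_vec_carrier)
  have "L *\<^sub>v (Z *\<^sub>v (L *\<^sub>v y)) = L *\<^sub>v y"
    using assoc_mult_mat_vec[OF mult_carrier_mat[OF L Zc] L y] assoc_mult_mat_vec[OF L Zc Ly] LZL
    by simp
  then show ?thesis using scalar_L[OF y ZLy] scalar_L[OF y y] by simp
qed

text \<open>
  A vector in the kernel of the deleted matrix, extended by 0 at u to a vector y, satisfies
  (L y)_k = 0 for k \<noteq> v. The remaining entry vanishes as well, because L y is orthogonal to the
  positive vector q. So y is a multiple of q with a zero entry, i.e. y = 0.
\<close>

lemma det_mat_delete_L:
  assumes u: "u < n" and v: "v < n"
  shows "det (mat_delete L v u) \<noteq> 0"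
proof
  assume "det (mat_delete L v u) = 0"
  then obtain x where x: "x \<in> carrier_vec (n - 1)" "x \<noteq> 0\<^sub>v (n - 1)"
    "mat_delete L v u *\<^sub>v x = 0\<^sub>v (n - 1)"
    using det_0_iff_vec_prod_zero[OF mat_delete_carrier[OF L]] by blast
  define y where "y = vec n (\<lambda>k. if k = u then 0 else x $ delete_index u k)"
  have y: "y \<in> carrier_vec n" "y $ u = 0" using u by (auto simp: y_def)
  have yx: "vec_delete y u = x"
    using x(1) y(1) by (intro eq_vecI) (auto simp: vec_delete_index[of _ n] y_def insert_index_less vec_delete_def)
  have Ly: "L *\<^sub>v y \<in> carrier_vec n" using L y(1) by (rule mult_mat_vec_carrier)
  have "vec_delete (L *\<^sub>v y) v = 0\<^sub>v (n - 1)"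
    using mat_delete_mult_vec_delete[OF L y(1) u v y(2)] yx x(3) by simp
  then have off: "(L *\<^sub>v y) $ k = 0" if "k < n" "k \<noteq> v" for k
  proof -
    have k: "delete_index v k < n - 1" using that v by (auto simp: delete_index_def)
    show ?thesis
      using \<open>vec_delete (L *\<^sub>v y) v = 0\<^sub>v (n - 1)\<close> vec_delete_index[OF Ly k, of v]
        insert_delete_index[OF that(2)] k by simp
  qed
  have "(\<Sum>k<n. q $ k * (L *\<^sub>v y) $ k) = 0"
    using q_scalar_L[OF y(1)] scalar_prod_sum[OF Ly] by simp
  moreover have "(\<Sum>k<n. q $ k * (L *\<^sub>v y) $ k) = (\<Sum>k\<in>{v}. q $ k * (L *\<^sub>v y) $ k)"
    using v off by (intro sum.mono_neutral_right) auto
  ultimately have "(L *\<^sub>v y) $ v = 0" using q_pos[OF v] by simp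
  then have "(L *\<^sub>v y) $ k = 0" if "k < n" for k using off that by blast
  then have "L *\<^sub>v y = 0\<^sub>v n" using carrier_matD[OF L] by (intro eq_vecI) auto
  with y(1) obtain c where c: "y = c \<cdot>\<^sub>v q" by (rule kernel_L)
  then have "c = 0" using y(2) q q_pos[OF u] u by simp
  then have "y = 0\<^sub>v n" using c q by auto
  then have "vec_delete y u = 0\<^sub>v (n - 1)"
    by (intro eq_vecI) (auto simp: vec_delete_def insert_index_less)
  then show False using x(2) yx by simp
qed

lemma scalar_deleted_inverse:
  assumes u: "u < n" and v: "v < n"
    and B: "inverts_mat (mat_delete L v u) B" "inverts_mat B (mat_delete L v u)"
    and y: "y \<in> carrier_vec n" "y $ u = 0" and z: "L *\<^sub>v y = z"
  shows "vec_delete z u \<bullet> (B *\<^sub>v vec_delete z v) = z \<bullet> y"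
proof -
  let ?M = "mat_delete L v u"
  have M: "?M \<in> carrier_mat (n - 1) (n - 1)" using L by (rule mat_delete_carrier)
  have yu: "vec_delete y u \<in> carrier_vec (n - 1)" using y(1) by (rule vec_delete_carrier)
  have "dim_col (?M * B) = n - 1" "dim_col (B * ?M) = dim_row B"
    using B M unfolding inverts_mat_def by (metis carrier_matD(1) index_one_mat(3))+
  then have Bc: "B \<in> carrier_mat (n - 1) (n - 1)" using M carrier_matD[OF L] by auto
  have "B *\<^sub>v vec_delete z v = B *\<^sub>v (?M *\<^sub>v vec_delete y u)"
    using mat_delete_mult_vec_delete[OF L y(1) u v y(2)] z by simp
  also have "\<dots> = vec_delete y u"
    using assoc_mult_mat_vec[OF Bc M yu] B(2) Bc yu by (simp add: inverts_mat_def)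
  finally show ?thesis
    using scalar_prod_vec_delete[OF _ y(1) u y(2), of z] z y(1) L by (auto simp: mult_mat_vec_carrier[OF L])
qed

text \<open>
  Without its entry i, the vector z is - 1 / q_j times a unit vector, so the quadratic form of the
  inverse is a single diagonal entry, a quotient of determinants by Cramer's rule.
\<close>

lemma deleted_inverse_diagonal:
  assumes ij: "i < n" "j < n" "j \<noteq> i"
  defines "M \<equiv> mat_delete L i i"
  shows "vec_delete (z_vec q i j) i \<bullet> (((1 / det M) \<cdot>\<^sub>m adj_mat M) *\<^sub>v vec_delete (z_vec q i j) i)
       = det (mat_delete_both L i j) / ((q $ j)\<^sup>2 * det M)"
proof -
  define k where "k = delete_index i j"
  have k: "k < n - 1" using ij by (auto simp: k_def delete_index_def)
  have ins: "insert_index i l = j \<longleftrightarrow> l = k" for l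
    using insert_delete_index[OF ij(3)] by (auto simp: k_def)
  have M: "M \<in> carrier_mat (n - 1) (n - 1)" unfolding M_def using L by (rule mat_delete_carrier)
  define B where "B = (1 / det M) \<cdot>\<^sub>m adj_mat M"
  have B: "B \<in> carrier_mat (n - 1) (n - 1)" using adj_mat[OF M] by (simp add: B_def)
  let ?e = "unit_vec (n - 1) k :: real vec"
  have z: "vec_delete (z_vec q i j) i = (- (1 / q $ j)) \<cdot>\<^sub>v ?e"
    using q ins by (intro eq_vecI)
      (auto simp: vec_delete_def z_vec_def insert_index_less unit_vec_def)
  have "((- (1 / q $ j)) \<cdot>\<^sub>v ?e) \<bullet> (B *\<^sub>v ((- (1 / q $ j)) \<cdot>\<^sub>v ?e))
      = (- (1 / q $ j)) * ((- (1 / q $ j)) * (?e \<bullet> (B *\<^sub>v ?e)))"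
    using B by (simp add: mult_mat_vec[OF B])
  also have "?e \<bullet> (B *\<^sub>v ?e) = B $$ (k, k)"
    using B k by (simp add: scalar_prod_left_unit[of _ "n - 1"])
  also have "B $$ (k, k) = det (mat_delete M k k) / det M"
    using M k by (simp add: B_def adj_mat_def cofactor_def)
  also have "mat_delete M k k = mat_delete_both L i j"
    by (simp add: M_def k_def mat_delete_both_def)
  finally show ?thesis
    unfolding z B_def[symmetric] by (simp add: power2_eq_square)
qed

end

section \<open>The weighted adjacency matrix\<close>

lemma perron_eigenpair_weighted_adjacency:
  fixes E :: "'e set"
  assumes G: "connected_weighted_multigraph n E ends w" and n: "n > 1"
    and A: "A = weighted_adjacency_mat n E ends w"
    and p: "perron_vector A p"
    and q: "q = (sqrt (real n) / vec_norm2 p) \<cdot>\<^sub>v p"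
  shows "perron_eigenpair n A (spec_rad A) q"
proof -
  interpret connected_weighted_multigraph n E ends w by (rule G)
  have Ac: "A \<in> carrier_mat n n" by (simp add: A weighted_adjacency_mat_def)
  have entry: "A $$ (i, j) = (\<Sum>e\<in>{e \<in> E. ends e = {i, j}}. w e)" if "i < n" "j < n" for i j
    using that by (simp add: A weighted_adjacency_mat_def)
  have pc: "p \<in> carrier_vec n" and eig: "A *\<^sub>v p = spec_rad A \<cdot>\<^sub>v p"
    and p_pos: "\<And>i. i < n \<Longrightarrow> p $ i > 0"
    using p Ac by (auto simp: perron_vector_def eigenvector_def)
  have ss: "(\<Sum>i<n. (p $ i)\<^sup>2) > 0"
    using p_pos n by (intro sum_pos2[of _ 0]) force+
  then have norm_pos: "vec_norm2 p > 0" using pc by (simp add: vec_norm2_def)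
  have norm_sq: "(vec_norm2 p)\<^sup>2 = p \<bullet> p"
    using ss pc by (simp add: vec_norm2_def scalar_prod_def lessThan_atLeast0 power2_eq_square)
  have rel: "adjacency_rel E ends \<subseteq> {(k, l). k < n \<and> l < n \<and> A $$ (k, l) > 0}"
  proof clarify
    fix k l assume "(k, l) \<in> adjacency_rel E ends"
    then obtain e where e: "e \<in> E" "ends e = {k, l}" by (auto simp: adjacency_rel_def)
    have kl: "k < n" "l < n" using edge_ends[OF e(1)] e(2) by (auto simp: doubleton_eq_iff)
    have "(\<Sum>e\<in>{e \<in> E. ends e = {k, l}}. w e) > 0"
      using e weight_pos finite_edges by (intro sum_pos) auto
    then show "k < n \<and> l < n \<and> A $$ (k, l) > 0" using kl entry by simp
  qed
  show ?thesis
  proof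
    show "A $$ (i, j) = A $$ (j, i)" if "i < n" "j < n" for i j
      using that by (simp add: entry insert_commute)
    show "0 \<le> A $$ (i, j)" if "i < n" "j < n" for i j
      unfolding entry[OF that] using weight_pos by (intro sum_nonneg) (auto simp: less_imp_le)
    show "(i, j) \<in> {(k, l). k < n \<and> l < n \<and> A $$ (k, l) > 0}\<^sup>*" if "i < n" "j < n" for i j
      using connected[OF that] rtrancl_mono[OF rel] by blast
    show "q \<in> carrier_vec n" using pc by (simp add: q)
    show "0 < q $ i" if "i < n" for i
      using that pc p_pos norm_pos n by (simp add: q)
    show "A *\<^sub>v q = spec_rad A \<cdot>\<^sub>v q"
      using mult_mat_vec[OF Ac pc] eig by (simp add: q smult_smult_assoc mult.commute)
    have "q \<bullet> q = (sqrt (real n) / vec_norm2 p)\<^sup>2 * (p \<bullet> p)"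
      using pc by (simp add: q power2_eq_square)
    then show "q \<bullet> q = real n"
      using norm_pos by (simp add: power_divide flip: norm_sq)
  qed (use Ac n in auto)
qed

theorem theorem2:
  fixes n :: nat and E :: "'e set" and ends :: "'e \<Rightarrow> nat set" and w :: "'e \<Rightarrow> real"
    and A L :: "real mat" and p p' :: "real vec" and i j :: nat
  assumes "connected_weighted_multigraph n E ends w"
    and "n > 1"
    and "A = weighted_adjacency_mat n E ends w"
    and "L = laplacian_like A"
    and "perron_vector A p"
    and "p' = (sqrt (real n) / vec_norm2 p) \<cdot>\<^sub>v p"
    and "i < n" and "j < n" and "j \<noteq> i"
  shows "long_walk_dist A i j =
           det (mat_delete_both L i j) / ((p' $ j)\<^sup>2 * det (mat_delete L i i))
       \<and> (\<forall>Z. g_inverse L Z \<longrightarrow>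
           long_walk_dist A i j = z_vec p' i j \<bullet> (Z *\<^sub>v z_vec p' i j))
       \<and> (\<forall>u<n. \<forall>v<n. invertible_mat (mat_delete L v u) \<and>
           (\<forall>B. inverts_mat (mat_delete L v u) B \<and> inverts_mat B (mat_delete L v u) \<longrightarrow>
             long_walk_dist A i j =
               vec_delete (z_vec p' i j) u \<bullet> (B *\<^sub>v vec_delete (z_vec p' i j) v)))"
proof -
  interpret perron_eigenpair n A "spec_rad A" p'
    using perron_eigenpair_weighted_adjacency[OF assms(1,2,3,5,6)] .
  note ij = \<open>i < n\<close> \<open>j < n\<close> \<open>j \<noteq> i\<close>
  have L_eq: "L = perron_eigenpair.L n A (spec_rad A)"
    using A by (simp add: assms(4) laplacian_like_def L_def)
  let ?z = "z_vec p' i j"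
  have dist: "long_walk_dist A i j = ?z \<bullet> y"
    if "y \<in> carrier_vec n" "L *\<^sub>v y = ?z" for y
    using tendsto_Lim[OF trivial_limit_at_left_real long_walk_tendsto[OF ij that[unfolded L_eq]]] A
    by (simp add: long_walk_dist_def)
  have minor: "long_walk_dist A i j = vec_delete ?z u \<bullet> (B *\<^sub>v vec_delete ?z v)"
    if "u < n" "v < n" "inverts_mat (mat_delete L v u) B" "inverts_mat B (mat_delete L v u)" for u v B
  proof -
    note uv = that
    obtain y where y: "y \<in> carrier_vec n" "L *\<^sub>v y = ?z" "y $ u = 0"
      unfolding L_eq by (rule z_equation_solution[OF ij uv(1)])
    show ?thesis
      using scalar_deleted_inverse[OF uv(1,2)] uv(3,4) y dist[OF y(1,2)] unfolding L_eq by simp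
  qed
  have inv: "det (mat_delete L v u) \<noteq> 0" "mat_delete L v u \<in> carrier_mat (n - 1) (n - 1)"
    if "u < n" "v < n" for u v
    using det_mat_delete_L[OF that] mat_delete_carrier[OF L] unfolding L_eq by auto
  have "long_walk_dist A i j = det (mat_delete_both L i j) / ((p' $ j)\<^sup>2 * det (mat_delete L i i))"
    using minor[OF ij(1) ij(1) det_nonzero_inverse(1,2)[OF inv(2,1)]] ij
      deleted_inverse_diagonal[OF ij] unfolding L_eq by simp
  moreover have "long_walk_dist A i j = ?z \<bullet> (Z *\<^sub>v ?z)" if "g_inverse L Z" for Z
  proof -
    obtain y where y: "y \<in> carrier_vec n" "L *\<^sub>v y = ?z"
      using z_equation_solution[OF ij ij(1)] unfolding L_eq by blast
    show ?thesis
      using scalar_g_inverse[of Z y] that y dist[OF y] unfolding L_eq by simp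
  qed
  ultimately show ?thesis
    using minor det_nonzero_inverse(3)[OF inv(2,1)] by blast
qed

end
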